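(* Let $\mathcal{C}$ be a small and well-founded category where every map factors as a strong epimorphism followed by a monomorphism. Let $X$ in $\widehat{\mathcal{C}}$ be strongly regular. For any $n \in \mathbb{N}$, $\dim X \leq n$ if and only if $\mathrm{IBD}_n$ holds in $\mathrm{D}X$.
   Context: $\mathbb{N}$ includes $0$. For a small category $\mathcal{C}$, $\widehat{\mathcal{C}}$ denotes the topos of presheaves (functors $\mathcal{C}^{\mathrm{op}} \to \mathbf{Set}$). For $X$ in $\widehat{\mathcal{C}}$, $\mathcal{C}/X$ denotes the category of elements of $X$: objects are pairs $(x,C)$ with $x \in XC$, and maps $(x,C)\to(y,D)$ are maps $f:C\to D$ in $\mathcal{C}$ with $y\cdot f = x$. A map is a strong epimorphism if it is left orthogonal to every monomorphism. $\mathcal{C}$ is well-founded if every chain $C_0 \xrightarrow{e_0} C_1 \xrightarrow{e_1} \cdots \to C_n \xrightarrow{e_n} \cdots$ of strong epimorphisms in $\mathcal{C}$ is eventually constant, i.e. there is $k \in \mathbb{N}$ such that $e_n$ is an isomorphism for all $n \geq k$. An object of a category is minimal if every map with that object as domain is monic. For a category $\mathcal{A}$, $\mathcal{A}^{\ast}$ denotes the full subcategory of minimal objects. A presheaf $X$ on $\mathcal{C}$ is strongly regular if, for every monic map in $\mathcal{C}/X$ with minimal codomain, the domain is also minimal. $\mathrm{D}X := \widehat{(\mathcal{C}/X)^{\ast}}$. Height: for $n\in\mathbb{N}$, an object $C$ of $\mathcal{C}$ has height below $n$, written $\mathfrak{h} C \leq n$, if every sequence $\cdot \to \cdot \to \cdots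 \to \cdot \to C$ of $n+1$ composable monomorphisms in $\mathcal{C}$ ending at $C$ contains an isomorphism. Let $\mathcal{C}_n \to \mathcal{C}$ be the full subcategory of objects of height below $n$. The inclusion induces an essential subtopos $n : \widehat{\mathcal{C}_n} \to \widehat{\mathcal{C}}$ with inverse image $n^*$ (restriction) and $n_! \dashv n^*$. The $n$-skeleton $\mathrm{Sk}_n X \to X$ is the image of the counit $n_!(n^*X)\to X$; explicitly, $(\mathrm{Sk}_n X)D$ consists of those $x \in XD$ such that there are a map $f : D \to E$ in $\mathcal{C}$ that factors through an object of $\mathcal{C}_n$ and a $y \in XE$ with $x = y \cdot f$. $X$ is $n$-skeletal, written $\dim X \leq n$, if $\mathrm{Sk}_n X \to X$ is an isomorphism. In the internal language of a topos with subobject classifier $\Omega$, define the closed formulas $\mathrm{IBD}_{-\infty} := \bot$, $\mathrm{IBD}_0 := (\forall x:\Omega)(x \vee (x\Rightarrow \mathrm{IBD}_{-\infty}))$, and $\mathrm{IBD}_{n+1} := (\forall x:\Omega)(x \vee (x \Rightarrow \mathrm{IBD}_n))$ for $n\in\mathbb{N}$. Each is interpreted as a subterminal object; $\mathrm{IBD}_n$ holds in the topos if this subterminal is the terminal object. *)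

theory Defs
  imports Main
begin

section \<open>Small categories\<close>

record ('o, 'a) cat =
  Ob :: "'o set"
  Arr :: "'a set"
  Dom :: "'a \<Rightarrow> 'o"
  Cod :: "'a \<Rightarrow> 'o"
  Ident :: "'o \<Rightarrow> 'a"
  Comp :: "'a \<Rightarrow> 'a \<Rightarrow> 'a" (infixl "\<cdot>\<index>" 70)

text \<open>Composition is written in applicative order: \<open>g \<cdot>\<^bsub>A\<^esub> f\<close> is ``first f, then g'', and is only
  meaningful when \<open>Dom A g = Cod A f\<close>.\<close>

locale small_category =
  fixes A (structure)
  assumes dom_in [simp]: "f \<in> Arr A \<Longrightarrow> Dom A f \<in> Ob A"
    and cod_in [simp]: "f \<in> Arr A \<Longrightarrow> Cod A f \<in> Ob A"
    and id_in [simp]: "a \<in> Ob A \<Longrightarrow> Ident A a \<in> Arr A"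
    and dom_id [simp]: "a \<in> Ob A \<Longrightarrow> Dom A (Ident A a) = a"
    and cod_id [simp]: "a \<in> Ob A \<Longrightarrow> Cod A (Ident A a) = a"
    and comp_in [simp]: "\<lbrakk>f \<in> Arr A; g \<in> Arr A; Dom A g = Cod A f\<rbrakk> \<Longrightarrow> g \<cdot> f \<in> Arr A"
    and dom_comp [simp]: "\<lbrakk>f \<in> Arr A; g \<in> Arr A; Dom A g = Cod A f\<rbrakk> \<Longrightarrow> Dom A (g \<cdot> f) = Dom A f"
    and cod_comp [simp]: "\<lbrakk>f \<in> Arr A; g \<in> Arr A; Dom A g = Cod A f\<rbrakk> \<Longrightarrow> Cod A (g \<cdot> f) = Cod A g"
    and comp_id_right [simp]: "f \<in> Arr A \<Longrightarrow> f \<cdot> Ident A (Dom A f) = f"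
    and comp_id_left [simp]: "f \<in> Arr A \<Longrightarrow> Ident A (Cod A f) \<cdot> f = f"
    and comp_assoc: "\<lbrakk>f \<in> Arr A; g \<in> Arr A; h \<in> Arr A; Dom A g = Cod A f; Dom A h = Cod A g\<rbrakk>
      \<Longrightarrow> (h \<cdot> g) \<cdot> f = h \<cdot> (g \<cdot> f)"

definition is_iso :: "('o, 'a, 'm) cat_scheme \<Rightarrow> 'a \<Rightarrow> bool" where
  "is_iso A f \<longleftrightarrow> f \<in> Arr A \<and>
     (\<exists>g\<in>Arr A. Dom A g = Cod A f \<and> Cod A g = Dom A f \<and>
        g \<cdot>\<^bsub>A\<^esub> f = Ident A (Dom A f) \<and> f \<cdot>\<^bsub>A\<^esub> g = Ident A (Cod A f))"

definition is_mono :: "('o, 'a, 'm) cat_scheme \<Rightarrow> 'a \<Rightarrow> bool" where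
  "is_mono A m \<longleftrightarrow> m \<in> Arr A \<and>
     (\<forall>g\<in>Arr A. \<forall>h\<in>Arr A. Cod A g = Dom A m \<and> Cod A h = Dom A m \<and> Dom A g = Dom A h \<and>
        m \<cdot>\<^bsub>A\<^esub> g = m \<cdot>\<^bsub>A\<^esub> h \<longrightarrow> g = h)"

text \<open>\<open>e\<close> is left orthogonal to \<open>m\<close>: every commutative square \<open>m u = v e\<close> has a unique diagonal.\<close>

definition left_orthogonal :: "('o, 'a, 'm) cat_scheme \<Rightarrow> 'a \<Rightarrow> 'a \<Rightarrow> bool" where
  "left_orthogonal A e m \<longleftrightarrow>
     (\<forall>u\<in>Arr A. \<forall>v\<in>Arr A.
        Dom A u = Dom A e \<and> Cod A u = Dom A m \<and> Dom A v = Cod A e \<and> Cod A v = Cod A m \<and>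
        m \<cdot>\<^bsub>A\<^esub> u = v \<cdot>\<^bsub>A\<^esub> e \<longrightarrow>
        (\<exists>!d. d \<in> Arr A \<and> Dom A d = Cod A e \<and> Cod A d = Dom A m \<and>
           d \<cdot>\<^bsub>A\<^esub> e = u \<and> m \<cdot>\<^bsub>A\<^esub> d = v))"

definition is_strong_epi :: "('o, 'a, 'm) cat_scheme \<Rightarrow> 'a \<Rightarrow> bool" where
  "is_strong_epi A e \<longleftrightarrow> e \<in> Arr A \<and> (\<forall>m. is_mono A m \<longrightarrow> left_orthogonal A e m)"

definition well_founded_cat :: "('o, 'a, 'm) cat_scheme \<Rightarrow> bool" where
  "well_founded_cat A \<longleftrightarrow>
     (\<forall>e :: nat \<Rightarrow> 'a. (\<forall>n. is_strong_epi A (e n) \<and> Cod A (e n) = Dom A (e (Suc n))) \<longrightarrow>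
        (\<exists>k. \<forall>n\<ge>k. is_iso A (e n)))"

definition has_strong_epi_mono_factorizations :: "('o, 'a, 'm) cat_scheme \<Rightarrow> bool" where
  "has_strong_epi_mono_factorizations A \<longleftrightarrow>
     (\<forall>f\<in>Arr A. \<exists>e m. is_strong_epi A e \<and> is_mono A m \<and> Dom A m = Cod A e \<and> f = m \<cdot>\<^bsub>A\<^esub> e)"

definition minimal_ob :: "('o, 'a, 'm) cat_scheme \<Rightarrow> 'o \<Rightarrow> bool" where
  "minimal_ob A a \<longleftrightarrow> a \<in> Ob A \<and> (\<forall>f\<in>Arr A. Dom A f = a \<longrightarrow> is_mono A f)"

definition full_subcat :: "('o, 'a) cat \<Rightarrow> ('o \<Rightarrow> bool) \<Rightarrow> ('o, 'a) cat" where
  "full_subcat A P =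
     A\<lparr>Ob := {a \<in> Ob A. P a}, Arr := {f \<in> Arr A. P (Dom A f) \<and> P (Cod A f)}\<rparr>"

definition minimal_subcat :: "('o, 'a) cat \<Rightarrow> ('o, 'a) cat" where
  "minimal_subcat A = full_subcat A (minimal_ob A)"

text \<open>The sequence \<open>m 0, \<dots>, m n\<close> consists of \<open>n + 1\<close> maps and ends at \<open>c\<close>.\<close>

definition height_le :: "('o, 'a, 'm) cat_scheme \<Rightarrow> 'o \<Rightarrow> nat \<Rightarrow> bool" where
  "height_le A c n \<longleftrightarrow>
     (\<forall>m :: nat \<Rightarrow> 'a.
        (\<forall>i\<le>n. is_mono A (m i)) \<and> (\<forall>i<n. Cod A (m i) = Dom A (m (Suc i))) \<and> Cod A (m n) = c \<longrightarrow>
        (\<exists>i\<le>n. is_iso A (m i)))"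

definition height_subcat :: "('o, 'a) cat \<Rightarrow> nat \<Rightarrow> ('o, 'a) cat" where
  "height_subcat A n = full_subcat A (\<lambda>c. height_le A c n)"


section \<open>Presheaves\<close>

text \<open>\<open>Act X x f\<close> is the restriction of \<open>x \<in> El X (Cod f)\<close> along \<open>f\<close>, an element of \<open>El X (Dom f)\<close>.\<close>

record ('o, 'a, 'x) psh =
  El :: "'o \<Rightarrow> 'x set"
  Act :: "'x \<Rightarrow> 'a \<Rightarrow> 'x"

locale presheaf = small_category A for A (structure) +
  fixes X :: "('o, 'a, 'x) psh"
  assumes act_in [simp]: "\<lbrakk>f \<in> Arr A; x \<in> El X (Cod A f)\<rbrakk> \<Longrightarrow> Act X x f \<in> El X (Dom A f)"
    and act_id [simp]: "\<lbrakk>a \<in> Ob A; x \<in> El X a\<rbrakk> \<Longrightarrow> Act X x (Ident A a) = x"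
    and act_comp: "\<lbrakk>f \<in> Arr A; g \<in> Arr A; Dom A g = Cod A f; x \<in> El X (Cod A g)\<rbrakk>
      \<Longrightarrow> Act X x (g \<cdot> f) = Act X (Act X x g) f"

definition natural :: "('o, 'a) cat \<Rightarrow> ('o, 'a, 'x) psh \<Rightarrow> ('o, 'a, 'y) psh \<Rightarrow>
    ('o \<Rightarrow> 'x \<Rightarrow> 'y) \<Rightarrow> bool" where
  "natural A P Q F \<longleftrightarrow>
     (\<forall>a\<in>Ob A. \<forall>x\<in>El P a. F a x \<in> El Q a) \<and>
     (\<forall>f\<in>Arr A. \<forall>x\<in>El P (Cod A f). F (Dom A f) (Act P x f) = Act Q (F (Cod A f) x) f)"

definition natural_iso :: "('o, 'a) cat \<Rightarrow> ('o, 'a, 'x) psh \<Rightarrow> ('o, 'a, 'y) psh \<Rightarrow>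
    ('o \<Rightarrow> 'x \<Rightarrow> 'y) \<Rightarrow> bool" where
  "natural_iso A P Q F \<longleftrightarrow> natural A P Q F \<and>
     (\<exists>G. natural A Q P G \<and>
        (\<forall>a\<in>Ob A. \<forall>x\<in>El P a. G a (F a x) = x) \<and>
        (\<forall>a\<in>Ob A. \<forall>y\<in>El Q a. F a (G a y) = y))"

text \<open>The category of elements.  A map \<open>(x, a) \<rightarrow> (y, b)\<close> carries its domain and codomain, since
  the same map \<open>f\<close> of \<open>A\<close> may underlie several maps.\<close>

definition elements ::
    "('o, 'a) cat \<Rightarrow> ('o, 'a, 'x) psh \<Rightarrow> ('x \<times> 'o, ('x \<times> 'o) \<times> 'a \<times> ('x \<times> 'o)) cat" where
  "elements A X = \<lparr>
     Ob = {(x, a). a \<in> Ob A \<and> x \<in> El X a},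
     Arr = {((x, a), f, (y, b)) | x a f y b. f \<in> Arr A \<and> Dom A f = a \<and> Cod A f = b \<and>
              x \<in> El X a \<and> y \<in> El X b \<and> Act X y f = x},
     Dom = (\<lambda>(p, f, q). p),
     Cod = (\<lambda>(p, f, q). q),
     Ident = (\<lambda>(x, a). ((x, a), Ident A a, (x, a))),
     Comp = (\<lambda>(_, g, r) (p, f, _). (p, g \<cdot>\<^bsub>A\<^esub> f, r))\<rparr>"

definition strongly_regular :: "('o, 'a) cat \<Rightarrow> ('o, 'a, 'x) psh \<Rightarrow> bool" where
  "strongly_regular A X \<longleftrightarrow>
     (\<forall>m. is_mono (elements A X) m \<and> minimal_ob (elements A X) (Cod (elements A X) m) \<longrightarrow>
        minimal_ob (elements A X) (Dom (elements A X) m))"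

definition factors_through :: "('o, 'a) cat \<Rightarrow> 'a \<Rightarrow> 'o \<Rightarrow> bool" where
  "factors_through A f c \<longleftrightarrow>
     (\<exists>g\<in>Arr A. \<exists>h\<in>Arr A. Dom A g = Dom A f \<and> Cod A g = c \<and> Dom A h = c \<and> Cod A h = Cod A f \<and>
        f = h \<cdot>\<^bsub>A\<^esub> g)"

definition skeleton :: "('o, 'a) cat \<Rightarrow> ('o, 'a, 'x) psh \<Rightarrow> nat \<Rightarrow> ('o, 'a, 'x) psh" where
  "skeleton A X n = \<lparr>
     El = (\<lambda>d. {x \<in> El X d. \<exists>f\<in>Arr A. Dom A f = d \<and>
             (\<exists>c \<in> Ob (height_subcat A n). factors_through A f c) \<and>
             (\<exists>y \<in> El X (Cod A f). x = Act X y f)}),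
     Act = Act X\<rparr>"

definition dim_le :: "('o, 'a) cat \<Rightarrow> ('o, 'a, 'x) psh \<Rightarrow> nat \<Rightarrow> bool" where
  "dim_le A X n \<longleftrightarrow> natural_iso A (skeleton A X n) X (\<lambda>_ x. x)"


section \<open>The internal language of a presheaf topos\<close>

subsection \<open>Subobjects\<close>

text \<open>A subobject of \<open>P\<close> is represented by its unique subpresheaf, as a family of sets that is empty
  outside the objects of \<open>A\<close>; thus the order and the lattice operations are those of functions.\<close>

definition subpresheaf :: "('o, 'a) cat \<Rightarrow> ('o, 'a, 'x) psh \<Rightarrow> ('o \<Rightarrow> 'x set) \<Rightarrow> bool" where
  "subpresheaf A P S \<longleftrightarrow>
     (\<forall>a. S a \<subseteq> (if a \<in> Ob A then El P a else {})) \<and>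
     (\<forall>f\<in>Arr A. \<forall>x\<in>S (Cod A f). Act P x f \<in> S (Dom A f))"

definition pullback :: "('o, 'a) cat \<Rightarrow> ('o, 'a, 'x) psh \<Rightarrow> ('o \<Rightarrow> 'x \<Rightarrow> 'y) \<Rightarrow>
    ('o \<Rightarrow> 'y set) \<Rightarrow> 'o \<Rightarrow> 'x set" where
  "pullback A P F S = (\<lambda>a. {x. a \<in> Ob A \<and> x \<in> El P a \<and> F a x \<in> S a})"

text \<open>Heyting implication of subobjects of \<open>P\<close>: the largest \<open>W\<close> with \<open>W \<sqinter> U \<le> V\<close>.\<close>

definition sub_imp :: "('o, 'a) cat \<Rightarrow> ('o, 'a, 'x) psh \<Rightarrow>
    ('o \<Rightarrow> 'x set) \<Rightarrow> ('o \<Rightarrow> 'x set) \<Rightarrow> 'o \<Rightarrow> 'x set" where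
  "sub_imp A P U V = Sup {W. subpresheaf A P W \<and> inf W U \<le> V}"

text \<open>Universal quantification along \<open>F : P \<rightarrow> Q\<close>, the right adjoint of pullback along \<open>F\<close>.\<close>

definition sub_all :: "('o, 'a) cat \<Rightarrow> ('o, 'a, 'x) psh \<Rightarrow> ('o, 'a, 'y) psh \<Rightarrow>
    ('o \<Rightarrow> 'x \<Rightarrow> 'y) \<Rightarrow> ('o \<Rightarrow> 'x set) \<Rightarrow> 'o \<Rightarrow> 'y set" where
  "sub_all A P Q F U = Sup {W. subpresheaf A Q W \<and> pullback A P F W \<le> U}"


subsection \<open>The subobject classifier and its powers\<close>

definition sieve :: "('o, 'a) cat \<Rightarrow> 'o \<Rightarrow> 'a set \<Rightarrow> bool" where
  "sieve A a S \<longleftrightarrow> S \<subseteq> {f \<in> Arr A. Cod A f = a} \<and>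
     (\<forall>f\<in>S. \<forall>g\<in>Arr A. Cod A g = Dom A f \<longrightarrow> f \<cdot>\<^bsub>A\<^esub> g \<in> S)"

definition Omega :: "('o, 'a) cat \<Rightarrow> ('o, 'a, 'a set) psh" where
  "Omega A = \<lparr>
     El = (\<lambda>a. {S. sieve A a S}),
     Act = (\<lambda>S f. {g \<in> Arr A. Cod A g = Dom A f \<and> f \<cdot>\<^bsub>A\<^esub> g \<in> S})\<rparr>"

definition truth :: "('o, 'a) cat \<Rightarrow> 'o \<Rightarrow> 'a set set" where
  "truth A = (\<lambda>a. {S. a \<in> Ob A \<and> S = {f \<in> Arr A. Cod A f = a}})"

text \<open>\<open>Omega_pow A k\<close> is the \<open>k\<close>-fold product of \<open>Omega A\<close>; for \<open>k = 0\<close> it is the terminal presheaf,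
  with the single element \<open>[]\<close> at every object.\<close>

definition Omega_pow :: "('o, 'a) cat \<Rightarrow> nat \<Rightarrow> ('o, 'a, 'a set list) psh" where
  "Omega_pow A k = \<lparr>
     El = (\<lambda>a. {xs. length xs = k \<and> set xs \<subseteq> El (Omega A) a}),
     Act = (\<lambda>xs f. map (\<lambda>S. Act (Omega A) S f) xs)\<rparr>"


subsection \<open>Formulas\<close>

text \<open>Formulas whose only type is \<open>\<Omega>\<close>, with de Bruijn indices; \<open>All \<phi>\<close> is \<open>(\<forall>x:\<Omega>) \<phi>\<close>.  A formula
  with free variables among \<open>Var 0, \<dots>, Var (k - 1)\<close> denotes a subobject of \<open>Omega_pow A k\<close>;
  quantification is along the projection that forgets the variable with index 0.\<close>

datatype fm = Var nat | Bot | Or fm fm | Imp fm fm | All fm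

primrec interp :: "('o, 'a) cat \<Rightarrow> nat \<Rightarrow> fm \<Rightarrow> 'o \<Rightarrow> 'a set list set" where
  "interp A k (Var i) = pullback A (Omega_pow A k) (\<lambda>_ xs. xs ! i) (truth A)"
| "interp A k Bot = bot"
| "interp A k (Or \<phi> \<psi>) = sup (interp A k \<phi>) (interp A k \<psi>)"
| "interp A k (Imp \<phi> \<psi>) = sub_imp A (Omega_pow A k) (interp A k \<phi>) (interp A k \<psi>)"
| "interp A k (All \<phi>) =
     sub_all A (Omega_pow A (Suc k)) (Omega_pow A k) (\<lambda>_. tl) (interp A (Suc k) \<phi>)"

text \<open>A closed formula holds in the topos of presheaves on \<open>A\<close> if the subterminal object it denotes is
  the terminal object.\<close>

definition holds_in_presheaves :: "('o, 'a) cat \<Rightarrow> fm \<Rightarrow> bool" where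
  "holds_in_presheaves A \<phi> \<longleftrightarrow> (\<forall>a\<in>Ob A. interp A 0 \<phi> a = El (Omega_pow A 0) a)"

definition IBD_minus_infinity :: fm where
  "IBD_minus_infinity = Bot"

text \<open>The subformula \<open>IBD n\<close> under the quantifier is closed, so its indices need no shift.\<close>

primrec IBD :: "nat \<Rightarrow> fm" where
  "IBD 0 = All (Or (Var 0) (Imp (Var 0) IBD_minus_infinity))"
| "IBD (Suc n) = All (Or (Var 0) (Imp (Var 0) (IBD n)))"


section \<open>Consistency of the definitions\<close>

lemma small_category_full_subcat:
  assumes "small_category A"
  shows "small_category (full_subcat A P)"
proof -
  interpret small_category A by fact
  show ?thesis
    by unfold_locales (auto simp: full_subcat_def comp_assoc)
qed

lemma small_category_elements:
  assumes "presheaf A X"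
  shows "small_category (elements A X)"
proof -
  interpret presheaf A X by fact
  show ?thesis
    by unfold_locales (auto simp: elements_def comp_assoc act_comp)
qed

lemma presheaf_skeleton:
  assumes "presheaf A X"
  shows "presheaf A (skeleton A X n)"
proof -
  interpret presheaf A X by fact
  show ?thesis
  proof unfold_locales
    fix f x assume f: "f \<in> Arr A" and "x \<in> El (skeleton A X n) (Cod A f)"
    then obtain g c y where x: "x \<in> El X (Cod A f)" and g: "g \<in> Arr A" "Dom A g = Cod A f"
      and c: "c \<in> Ob (height_subcat A n)" "factors_through A g c"
      and y: "y \<in> El X (Cod A g)" "x = Act X y g"
      by (auto simp: skeleton_def)
    from c(2) obtain p q where pq: "p \<in> Arr A" "q \<in> Arr A" "Dom A p = Dom A g" "Cod A p = c"
      "Dom A q = c" "Cod A q = Cod A g" "g = q \<cdot>\<^bsub>A\<^esub> p"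
      by (auto simp: factors_through_def)
    have "factors_through A (g \<cdot>\<^bsub>A\<^esub> f) c"
      unfolding factors_through_def
    proof (intro bexI conjI)
      show "g \<cdot>\<^bsub>A\<^esub> f = q \<cdot>\<^bsub>A\<^esub> (p \<cdot>\<^bsub>A\<^esub> f)"
        unfolding pq(7) by (rule comp_assoc) (simp_all only: f g pq(1-6))
    qed (simp_all only: f g pq(1-6) comp_in dom_comp cod_comp)
    moreover have "Act X x f = Act X y (g \<cdot>\<^bsub>A\<^esub> f)"
      using f g y by (simp add: act_comp)
    ultimately have "\<exists>h\<in>Arr A. Dom A h = Dom A f \<and>
        (\<exists>c \<in> Ob (height_subcat A n). factors_through A h c) \<and>
        (\<exists>z \<in> El X (Cod A h). Act X x f = Act X z h)"
      using f g y c(1) by (intro bexI[of _ "g \<cdot>\<^bsub>A\<^esub> f"]) auto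
    then show "Act (skeleton A X n) x f \<in> El (skeleton A X n) (Dom A f)"
      using f x by (simp add: skeleton_def)
  qed (auto simp: skeleton_def act_comp)
qed

lemma presheaf_Omega:
  assumes "small_category A"
  shows "presheaf A (Omega A)"
proof -
  interpret small_category A by fact
  show ?thesis
  proof unfold_locales
    fix f g S assume a: "f \<in> Arr A" "g \<in> Arr A" "Dom A g = Cod A f" "S \<in> El (Omega A) (Cod A g)"
    then show "Act (Omega A) S (g \<cdot>\<^bsub>A\<^esub> f) = Act (Omega A) (Act (Omega A) S g) f"
      by (auto simp: Omega_def comp_assoc)
  next
    fix a S assume a: "a \<in> Ob A" "S \<in> El (Omega A) a"
    then show "Act (Omega A) S (Ident A a) = S"
      using comp_id_left by (fastforce simp: Omega_def sieve_def)
  next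
    fix f S assume a: "f \<in> Arr A" "S \<in> El (Omega A) (Cod A f)"
    then show "Act (Omega A) S f \<in> El (Omega A) (Dom A f)"
      by (auto simp: Omega_def sieve_def comp_assoc[symmetric])
  qed
qed

lemma presheaf_Omega_pow:
  assumes "small_category A"
  shows "presheaf A (Omega_pow A k)"
proof -
  interpret O: presheaf A "Omega A" by (rule presheaf_Omega[OF assms])
  show ?thesis
  proof unfold_locales
    fix f xs assume "f \<in> Arr A" "xs \<in> El (Omega_pow A k) (Cod A f)"
    then show "Act (Omega_pow A k) xs f \<in> El (Omega_pow A k) (Dom A f)"
      by (auto simp: Omega_pow_def)
  next
    fix a xs assume "a \<in> Ob A" "xs \<in> El (Omega_pow A k) a"
    then show "Act (Omega_pow A k) xs (Ident A a) = xs"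
      by (auto simp: Omega_pow_def intro!: map_idI)
  next
    fix f g xs
    assume "f \<in> Arr A" "g \<in> Arr A" "Dom A g = Cod A f" "xs \<in> El (Omega_pow A k) (Cod A g)"
    then show "Act (Omega_pow A k) xs (g \<cdot>\<^bsub>A\<^esub> f) = Act (Omega_pow A k) (Act (Omega_pow A k) xs g) f"
      by (auto simp: Omega_pow_def O.act_comp)
  qed
qed

lemma subpresheaf_Sup:
  assumes "\<And>W. W \<in> M \<Longrightarrow> subpresheaf A P W"
  shows "subpresheaf A P (Sup M)"
  unfolding subpresheaf_def
proof (intro conjI allI ballI)
  fix a
  have "W a \<subseteq> (if a \<in> Ob A then El P a else {})" if "W \<in> M" for W
    using assms[OF that] unfolding subpresheaf_def by blast
  then show "Sup M a \<subseteq> (if a \<in> Ob A then El P a else {})"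
    unfolding Sup_apply by (rule SUP_least)
next
  fix f x assume "f \<in> Arr A" "x \<in> Sup M (Cod A f)"
  then show "Act P x f \<in> Sup M (Dom A f)"
    using assms unfolding subpresheaf_def Sup_apply by blast
qed

lemma subpresheaf_sub_imp: "subpresheaf A P (sub_imp A P U V)"
  unfolding sub_imp_def by (rule subpresheaf_Sup) simp

lemma subpresheaf_sub_all: "subpresheaf A Q (sub_all A P Q F U)"
  unfolding sub_all_def by (rule subpresheaf_Sup) simp

lemma sub_imp_adjunction:
  assumes "subpresheaf A P W"
  shows "W \<le> sub_imp A P U V \<longleftrightarrow> inf W U \<le> V"
proof
  assume "W \<le> sub_imp A P U V"
  then have "inf W U \<le> inf (sub_imp A P U V) U"
    by (rule inf_mono) simp
  also have "inf (sub_imp A P U V) U \<le> V"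
    by (auto simp: sub_imp_def le_fun_def)
  finally show "inf W U \<le> V" .
next
  assume "inf W U \<le> V"
  then show "W \<le> sub_imp A P U V"
    unfolding sub_imp_def using assms by (intro Sup_upper) simp
qed

lemma sub_all_adjunction:
  assumes "subpresheaf A Q W"
  shows "W \<le> sub_all A P Q F U \<longleftrightarrow> pullback A P F W \<le> U"
proof
  assume "W \<le> sub_all A P Q F U"
  then have "pullback A P F W \<le> pullback A P F (sub_all A P Q F U)"
    by (auto simp: pullback_def le_fun_def)
  also have "pullback A P F (sub_all A P Q F U) \<le> U"
    by (auto simp: pullback_def sub_all_def le_fun_def)
  finally show "pullback A P F W \<le> U" .
next
  assume "pullback A P F W \<le> U"
  then show "W \<le> sub_all A P Q F U"
    unfolding sub_all_def using assms by (intro Sup_upper) simp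
qed

lemma Omega_classifies:
  assumes "presheaf A P" and S: "subpresheaf A P S"
  shows "\<exists>F. natural A P (Omega A) F \<and> pullback A P F (truth A) = S \<and>
    (\<forall>G. natural A P (Omega A) G \<and> pullback A P G (truth A) = S \<longrightarrow>
       (\<forall>a\<in>Ob A. \<forall>x\<in>El P a. G a x = F a x))"
proof -
  interpret presheaf A P by fact
  define F where "F a x = {f \<in> Arr A. Cod A f = a \<and> Act P x f \<in> S (Dom A f)}" for a x
  have 1: "natural A P (Omega A) F"
    using S unfolding natural_def F_def Omega_def sieve_def subpresheaf_def
    by (auto simp: act_comp)
  have 2: "pullback A P F (truth A) = S"
  proof (intro ext set_eqI iffI)
    fix a x assume "x \<in> pullback A P F (truth A) a"
    then have a: "a \<in> Ob A" "x \<in> El P a" "F a x = {f \<in> Arr A. Cod A f = a}"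
      by (auto simp: pullback_def truth_def)
    then have "Ident A a \<in> F a x" by simp
    then show "x \<in> S a" using a(1,2) by (simp add: F_def)
  next
    fix a x assume "x \<in> S a"
    moreover have "a \<in> Ob A" "x \<in> El P a"
      using \<open>x \<in> S a\<close> S unfolding subpresheaf_def
      by (cases "a \<in> Ob A"; force dest!: spec[of _ a])+
    ultimately show "x \<in> pullback A P F (truth A) a"
      using S by (auto simp: pullback_def truth_def F_def subpresheaf_def)
  qed
  have 3: "G a x = F a x"
    if G: "natural A P (Omega A) G" "pullback A P G (truth A) = S" and a: "a \<in> Ob A" "x \<in> El P a"
    for G a x
  proof (rule set_eqI)
    fix f
    show "f \<in> G a x \<longleftrightarrow> f \<in> F a x"
    proof (cases "f \<in> Arr A \<and> Cod A f = a")
      case False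
      moreover have "sieve A a (G a x)"
        using G(1) a by (auto simp: natural_def Omega_def)
      ultimately show ?thesis by (auto simp: sieve_def F_def)
    next
      case True
      have sv: "sieve A a (G a x)"
        using G(1) a by (auto simp: natural_def Omega_def)
      have eq: "G (Dom A f) (Act P x f) = {g \<in> Arr A. Cod A g = Dom A f \<and> f \<cdot>\<^bsub>A\<^esub> g \<in> G a x}"
        using G(1) True a by (auto simp: natural_def Omega_def)
      have "f \<in> F a x \<longleftrightarrow> Act P x f \<in> pullback A P G (truth A) (Dom A f)"
        using True G(2) by (simp add: F_def)
      also have "\<dots> \<longleftrightarrow> G (Dom A f) (Act P x f) = {g \<in> Arr A. Cod A g = Dom A f}"
        using True a by (auto simp: pullback_def truth_def)
      also have "\<dots> \<longleftrightarrow> f \<in> G a x"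
      proof
        assume "G (Dom A f) (Act P x f) = {g \<in> Arr A. Cod A g = Dom A f}"
        then have "Ident A (Dom A f) \<in> G (Dom A f) (Act P x f)" using True by simp
        then show "f \<in> G a x" using eq True by simp
      next
        assume "f \<in> G a x"
        then show "G (Dom A f) (Act P x f) = {g \<in> Arr A. Cod A g = Dom A f}"
          using eq sv by (auto simp: sieve_def)
      qed
      finally show ?thesis by simp
    qed
  qed
  show ?thesis
    by (rule exI[of _ F]) (use 1 2 3 in blast)
qed

end

theory Submission
  imports Defs
begin

text \<open>
  By Kripke--Joyal semantics, \<open>IBD\<^sub>n\<close> is forced at \<open>a\<close> in presheaves on a category of monomorphisms
  iff \<open>a\<close> has height at most \<open>n\<close>: principal sieves are the only ones that matter, the sieve generated
  by \<open>h\<close> is maximal iff \<open>h\<close> is split epi, and a split epi mono is invertible.  For the category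
  \<open>(C/X)\<^sup>*\<close> the discrete fibration \<open>C/X \<rightarrow> C\<close> and strong regularity identify this height with the
  height in \<open>C\<close>.  So it remains to see that \<open>dim X \<le> n\<close> iff \<open>a\<close> has height at most \<open>n\<close> for every
  minimal \<open>(x, a)\<close>.  Well-foundedness gives every element a map to a minimal one, so the heights bound
  the dimension; conversely a minimal \<open>(x, a)\<close> in the \<open>n\<close>-skeleton has a map, necessarily monic, to
  an object of height at most \<open>n\<close>, and height decreases along monos.\<close>

section \<open>Height\<close>

definition is_split_epi :: "('o, 'a, 'm) cat_scheme \<Rightarrow> 'a \<Rightarrow> bool" where
  "is_split_epi A h \<longleftrightarrow> h \<in> Arr A \<and>
     (\<exists>s\<in>Arr A. Dom A s = Cod A h \<and> Cod A s = Dom A h \<and> h \<cdot>\<^bsub>A\<^esub> s = Ident A (Cod A h))"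

lemma is_mono_in_Arr: "is_mono A m \<Longrightarrow> m \<in> Arr A"
  by (simp add: is_mono_def)

lemma is_monoD:
  assumes "is_mono A m" "g \<in> Arr A" "h \<in> Arr A" "Cod A g = Dom A m" "Cod A h = Dom A m"
    "Dom A g = Dom A h" "m \<cdot>\<^bsub>A\<^esub> g = m \<cdot>\<^bsub>A\<^esub> h"
  shows "g = h"
  using assms unfolding is_mono_def by blast

section \<open>Height as a recursion along monomorphisms\<close>

lemma height_le_0: "height_le A c 0 \<longleftrightarrow> (\<forall>m. is_mono A m \<and> Cod A m = c \<longrightarrow> is_iso A m)"
proof
  assume L: "height_le A c 0"
  show "\<forall>m. is_mono A m \<and> Cod A m = c \<longrightarrow> is_iso A m"
  proof (intro allI impI)
    fix m assume "is_mono A m \<and> Cod A m = c"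
    then show "is_iso A m"
      using L[unfolded height_le_def, rule_format, of "\<lambda>_. m"] by simp
  qed
qed (simp add: height_le_def)

text \<open>A chain of \<open>n + 2\<close> monos ending at \<open>c\<close> is a mono into
  \<open>c\<close> preceded by a chain of \<open>n + 1\<close> monos ending at its domain. This
  recursion has the shape of the one that defines \<open>IBD (Suc n)\<close>.\<close>

lemma height_le_Suc:
  "height_le A c (Suc n) \<longleftrightarrow>
     (\<forall>m. is_mono A m \<and> Cod A m = c \<longrightarrow> is_iso A m \<or> height_le A (Dom A m) n)"
proof (intro iffI allI impI)
  fix m assume L: "height_le A c (Suc n)" and m: "is_mono A m \<and> Cod A m = c"
  show "is_iso A m \<or> height_le A (Dom A m) n"
  proof (rule disjCI)
    assume nh: "\<not> height_le A (Dom A m) n"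
    then obtain k where k: "\<forall>i\<le>n. is_mono A (k i)" "\<forall>i<n. Cod A (k i) = Dom A (k (Suc i))"
      "Cod A (k n) = Dom A m" "\<forall>i\<le>n. \<not> is_iso A (k i)"
      unfolding height_le_def by blast
    \<comment> \<open>Appending \<open>m\<close> to a chain without isomorphisms leaves
      \<open>m\<close> as the only candidate for the isomorphism that the height bound
      provides.\<close>
    define j where "j = (\<lambda>i. if i = Suc n then m else k i)"
    have "\<exists>i\<le>Suc n. is_iso A (j i)"
      by (rule L[unfolded height_le_def, rule_format]) (use k m in \<open>auto simp: j_def less_Suc_eq\<close>)
    then show "is_iso A m"
      using k(4) by (auto simp: j_def le_Suc_eq split: if_splits)
  qed
next
  assume R: "\<forall>m. is_mono A m \<and> Cod A m = c \<longrightarrow> is_iso A m \<or> height_le A (Dom A m) n"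
  show "height_le A c (Suc n)"
    unfolding height_le_def
  proof (intro allI impI)
    fix k :: "nat \<Rightarrow> 'b"
    assume k: "(\<forall>i\<le>Suc n. is_mono A (k i)) \<and> (\<forall>i<Suc n. Cod A (k i) = Dom A (k (Suc i))) \<and>
      Cod A (k (Suc n)) = c"
    then have "is_iso A (k (Suc n)) \<or> height_le A (Dom A (k (Suc n))) n"
      using R by simp
    then show "\<exists>i\<le>Suc n. is_iso A (k i)"
    proof
      assume "height_le A (Dom A (k (Suc n))) n"
      then have "\<exists>i\<le>n. is_iso A (k i)"
        using k unfolding height_le_def by simp
      then show ?thesis using le_Suc_eq by blast
    qed blast
  qed
qed

text \<open>Induction along the recursion for height: \<open>push\<close> and \<open>lift\<close>
  make \<open>F\<close> a bounded morphism for the relation that sends an object to the domains of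
  the non-invertible monos into it. A mono obtained from \<open>lift\<close> again has its domain in
  \<open>P\<close>, by \<open>push\<close>.\<close>

lemma height_le_transfer:
  assumes "p \<in> P"
    and push: "\<And>p f. \<lbrakk>p \<in> P; is_mono A f; Cod A f = p\<rbrakk> \<Longrightarrow>
      Dom A f \<in> P \<and> (\<exists>m. is_mono B m \<and> Cod B m = F p \<and> Dom B m = F (Dom A f) \<and>
        (is_iso B m \<longleftrightarrow> is_iso A f))"
    and lift: "\<And>p m. \<lbrakk>p \<in> P; is_mono B m; Cod B m = F p\<rbrakk> \<Longrightarrow>
      \<exists>f. is_mono A f \<and> Cod A f = p \<and> Dom B m = F (Dom A f) \<and> (is_iso B m \<longleftrightarrow> is_iso A f)"
  shows "height_le A p n \<longleftrightarrow> height_le B (F p) n"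
  using \<open>p \<in> P\<close>
proof (induction n arbitrary: p)
  case 0
  then show ?case unfolding height_le_0 by (metis push lift)
next
  case (Suc n)
  then show ?case unfolding height_le_Suc by (metis push lift)
qed

section \<open>Cancellation of monomorphisms and its effect on height\<close>

context small_category
begin

lemma iso_of_split_epi_mono:
  assumes h: "is_split_epi A h" and m: "is_mono A h"
  shows "is_iso A h"
proof -
  from h obtain s where h': "h \<in> Arr A" and s: "s \<in> Arr A" "Dom A s = Cod A h" "Cod A s = Dom A h"
    "h \<cdot> s = Ident A (Cod A h)"
    unfolding is_split_epi_def by blast
  have "h \<cdot> (s \<cdot> h) = h \<cdot> Ident A (Dom A h)"
    using h' s comp_assoc[of h s h] by simp
  then have "s \<cdot> h = Ident A (Dom A h)"
    using is_monoD[OF m, of "s \<cdot> h" "Ident A (Dom A h)"] h' s by simp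
  then show ?thesis unfolding is_iso_def using h' s by blast
qed

lemma split_epi_of_iso: "is_iso A h \<Longrightarrow> is_split_epi A h"
  unfolding is_iso_def is_split_epi_def by blast

lemma mono_of_iso:
  assumes "is_iso A f"
  shows "is_mono A f"
proof -
  from assms obtain s where f: "f \<in> Arr A" and s: "s \<in> Arr A" "Dom A s = Cod A f"
    "Cod A s = Dom A f" "s \<cdot> f = Ident A (Dom A f)"
    unfolding is_iso_def by blast
  show ?thesis
    unfolding is_mono_def
  proof (intro conjI ballI impI f)
    fix g h assume g: "g \<in> Arr A" and h: "h \<in> Arr A"
      and e: "Cod A g = Dom A f \<and> Cod A h = Dom A f \<and> Dom A g = Dom A h \<and> f \<cdot> g = f \<cdot> h"
    have "g = (s \<cdot> f) \<cdot> g" using e s g comp_id_left[of g] by simp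
    also have "\<dots> = s \<cdot> (f \<cdot> h)" using comp_assoc[of g f s] e f g s by simp
    also have "\<dots> = (s \<cdot> f) \<cdot> h" using comp_assoc[of h f s] e f h s by simp
    also have "\<dots> = h" using e s h comp_id_left[of h] by simp
    finally show "g = h" .
  qed
qed

lemma mono_comp:
  assumes m: "is_mono A m" and k: "is_mono A k" and e: "Dom A k = Cod A m"
  shows "is_mono A (k \<cdot> m)"
  unfolding is_mono_def
proof (intro conjI ballI impI)
  note arr = is_mono_in_Arr[OF m] is_mono_in_Arr[OF k]
  then show "k \<cdot> m \<in> Arr A" using e by simp
  fix g h assume gh: "g \<in> Arr A" "h \<in> Arr A"
    and c: "Cod A g = Dom A (k \<cdot> m) \<and> Cod A h = Dom A (k \<cdot> m) \<and> Dom A g = Dom A h \<and>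
      k \<cdot> m \<cdot> g = k \<cdot> m \<cdot> h"
  have c': "Cod A g = Dom A m" "Cod A h = Dom A m" using c arr e by auto
  then have "k \<cdot> (m \<cdot> g) = k \<cdot> (m \<cdot> h)"
    using c gh arr e comp_assoc[of g m k] comp_assoc[of h m k] by simp
  then have "m \<cdot> g = m \<cdot> h"
    using is_monoD[OF k, of "m \<cdot> g" "m \<cdot> h"] c c' gh arr e by simp
  then show "g = h"
    using is_monoD[OF m, of g h] c c' gh by simp
qed

text \<open>If \<open>s\<close> inverts \<open>k \<cdot> m\<close>, then \<open>m \<cdot> s\<close>
  is a section of \<open>k\<close>. Cancelling the mono \<open>k\<close> turns this into a section
  \<open>s \<cdot> k\<close> of \<open>m\<close>, and a split epi mono is invertible.\<close>

lemma iso_of_mono_comp_iso: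
  assumes m: "is_mono A m" and k: "is_mono A k" and e: "Dom A k = Cod A m"
    and i: "is_iso A (k \<cdot> m)"
  shows "is_iso A m"
proof -
  note arr = is_mono_in_Arr[OF m] is_mono_in_Arr[OF k]
  obtain s where s: "s \<in> Arr A" "Dom A s = Cod A k" "Cod A s = Dom A m"
    "k \<cdot> m \<cdot> s = Ident A (Cod A k)"
    using i arr e unfolding is_iso_def by auto
  have ks: "k \<cdot> (m \<cdot> s) = Ident A (Cod A k)"
    using comp_assoc[of s m k] s arr e by simp
  have "k \<cdot> (m \<cdot> (s \<cdot> k)) = k \<cdot> Ident A (Dom A k)"
    using comp_assoc[of k "m \<cdot> s" k] comp_assoc[of k s m] comp_id_right[of k] ks s arr e by simp
  then have "m \<cdot> (s \<cdot> k) = Ident A (Cod A m)"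
    using is_monoD[OF k, of "m \<cdot> (s \<cdot> k)" "Ident A (Dom A k)"] s arr e by simp
  then have "is_split_epi A m"
    unfolding is_split_epi_def using s arr e by (auto intro!: bexI[of _ "s \<cdot> k"])
  then show ?thesis using m by (rule iso_of_split_epi_mono)
qed

text \<open>Composing the last map of a chain with \<open>g\<close> moves its end from the domain to
  the codomain of \<open>g\<close> and creates no new isomorphism. Only that last map changes, so
  one unfolding of the recursion suffices.\<close>

lemma height_le_mono_dom:
  assumes g: "is_mono A g" and h: "height_le A (Cod A g) n"
  shows "height_le A (Dom A g) n"
proof -
  have *: "is_mono A (g \<cdot> m) \<and> Cod A (g \<cdot> m) = Cod A g \<and> Dom A (g \<cdot> m) = Dom A m \<and>
      (is_iso A (g \<cdot> m) \<longrightarrow> is_iso A m)"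
    if "is_mono A m" "Cod A m = Dom A g" for m
    using that g mono_comp iso_of_mono_comp_iso is_mono_in_Arr[OF g] is_mono_in_Arr[of A m] by simp
  show ?thesis
  proof (cases n)
    case 0
    then show ?thesis using h * by (auto simp: height_le_0)
  next
    case (Suc k)
    then show ?thesis using h * unfolding Suc height_le_Suc by metis
  qed
qed

end

section \<open>Forcing\<close>

lemma subpresheafD:
  assumes "subpresheaf A P S" "x \<in> S a"
  shows "a \<in> Ob A" "x \<in> El P a"
proof -
  have "S a \<subseteq> (if a \<in> Ob A then El P a else {})"
    using assms(1) unfolding subpresheaf_def by blast
  then show "a \<in> Ob A" "x \<in> El P a"
    using assms(2) by (auto split: if_splits)
qed

text \<open>The definitions of the internal language only apply to unextended \<open>cat\<close> records.\<close>

locale cat_category = small_category A for A :: "('o, 'a) cat" (structure)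

locale cat_presheaf = presheaf A X for A :: "('o, 'a) cat" (structure) and X :: "('o, 'a, 'x) psh"

section \<open>Kripke-Joyal clauses for implication and universal quantification\<close>

context cat_presheaf
begin

text \<open>The condition on the right is stable under restriction, and at identities it yields
  \<open>inf W U \<le> V\<close>, so the adjunction places it below the Heyting implication.
  Conversely every competing \<open>W\<close> satisfies it.\<close>

lemma sub_imp_iff:
  "x \<in> sub_imp A X U V a \<longleftrightarrow> a \<in> Ob A \<and> x \<in> El X a \<and>
     (\<forall>f\<in>Arr A. Cod A f = a \<and> Act X x f \<in> U (Dom A f) \<longrightarrow> Act X x f \<in> V (Dom A f))"
  (is "_ \<longleftrightarrow> ?R a x")
proof
  assume "x \<in> sub_imp A X U V a"
  then obtain W where W: "subpresheaf A X W" "inf W U \<le> V" "x \<in> W a"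
    unfolding sub_imp_def by auto
  then have "a \<in> Ob A \<and> x \<in> El X a"
    by (blast dest: subpresheafD)
  moreover have "Act X x f \<in> V (Dom A f)"
    if "f \<in> Arr A" "Cod A f = a" "Act X x f \<in> U (Dom A f)" for f
  proof -
    have "Act X x f \<in> W (Dom A f)" using W that unfolding subpresheaf_def by blast
    then show ?thesis using W(2) that by (auto simp: le_fun_def)
  qed
  ultimately show "?R a x" by blast
next
  assume R: "?R a x"
  define W where "W = (\<lambda>a. {x. ?R a x})"
  have "subpresheaf A X W"
    unfolding subpresheaf_def
  proof (intro conjI allI ballI)
    fix f x assume f: "f \<in> Arr A" and x: "x \<in> W (Cod A f)"
    have "Act X (Act X x f) g \<in> V (Dom A g)"
      if "g \<in> Arr A" "Cod A g = Dom A f" "Act X (Act X x f) g \<in> U (Dom A g)" for g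
      using x f that act_comp[of g f x, symmetric] unfolding W_def
      by (auto dest: bspec[of _ _ "f \<cdot> g"])
    then show "Act X x f \<in> W (Dom A f)"
      using x f unfolding W_def by simp
  qed (auto simp: W_def)
  moreover have "inf W U \<le> V"
  proof (intro le_funI subsetI)
    fix a x assume "x \<in> inf W U a"
    then show "x \<in> V a"
      unfolding W_def by (auto dest: bspec[of _ _ "Ident A a"])
  qed
  ultimately have "W \<le> sub_imp A X U V"
    by (simp add: sub_imp_adjunction)
  then show "x \<in> sub_imp A X U V a"
    using R unfolding le_fun_def W_def by blast
qed

text \<open>The argument is that for implication, with the fibres of \<open>F\<close> over all
  restrictions of \<open>y\<close> in place of \<open>U\<close>.\<close>

lemma sub_all_iff:
  assumes P: "presheaf A P" and F: "natural A P X F"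
  shows "y \<in> sub_all A P X F U a \<longleftrightarrow> a \<in> Ob A \<and> y \<in> El X a \<and>
     (\<forall>f\<in>Arr A. Cod A f = a \<longrightarrow>
        (\<forall>x\<in>El P (Dom A f). F (Dom A f) x = Act X y f \<longrightarrow> x \<in> U (Dom A f)))"
  (is "_ \<longleftrightarrow> ?R a y")
proof
  assume "y \<in> sub_all A P X F U a"
  then obtain W where W: "subpresheaf A X W" "pullback A P F W \<le> U" "y \<in> W a"
    unfolding sub_all_def by auto
  then have "a \<in> Ob A \<and> y \<in> El X a"
    by (blast dest: subpresheafD)
  moreover have "x \<in> U (Dom A f)"
    if f: "f \<in> Arr A" "Cod A f = a" and x: "x \<in> El P (Dom A f)" "F (Dom A f) x = Act X y f" for f x
  proof -
    have "Act X y f \<in> W (Dom A f)" using W f unfolding subpresheaf_def by blast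
    then have "x \<in> pullback A P F W (Dom A f)" using f x by (simp add: pullback_def)
    then show ?thesis using W(2) by (auto simp: le_fun_def)
  qed
  ultimately show "?R a y" by blast
next
  assume R: "?R a y"
  define W where "W = (\<lambda>a. {y. ?R a y})"
  have sub: "subpresheaf A X W"
    unfolding subpresheaf_def
  proof (intro conjI allI ballI)
    fix f y assume f: "f \<in> Arr A" and y: "y \<in> W (Cod A f)"
    have "x \<in> U (Dom A g)"
      if "g \<in> Arr A" "Cod A g = Dom A f" "x \<in> El P (Dom A g)"
        "F (Dom A g) x = Act X (Act X y f) g" for g x
      using y f that act_comp[of g f y, symmetric] unfolding W_def
      by (auto dest: bspec[of _ _ "f \<cdot> g"])
    then show "Act X y f \<in> W (Dom A f)"
      using y f unfolding W_def by simp
  qed (auto simp: W_def)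
  have "pullback A P F W \<le> U"
  proof (intro le_funI subsetI)
    fix a x assume "x \<in> pullback A P F W a"
    then show "x \<in> U a"
      unfolding W_def pullback_def by (auto dest: bspec[of _ _ "Ident A a"])
  qed
  then have "W \<le> sub_all A P X F U"
    by (simp add: sub_all_adjunction[OF sub])
  then show "y \<in> sub_all A P X F U a"
    using R unfolding le_fun_def W_def by blast
qed

end

section \<open>Forcing of the formulas IBD\<close>

context cat_category
begin

lemma natural_tl: "natural A (Omega_pow A (Suc k)) (Omega_pow A k) (\<lambda>_. tl)"
  unfolding natural_def Omega_pow_def by (auto simp: map_tl dest: list.set_sel(2)[rotated])

lemma Omega_pow_Suc_iff:
  "ys \<in> El (Omega_pow A (Suc k)) a \<longleftrightarrow>
     (\<exists>S xs. ys = S # xs \<and> sieve A a S \<and> xs \<in> El (Omega_pow A k) a)"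
  by (auto simp: Omega_pow_def Omega_def length_Suc_conv)

text \<open>Truth is the maximal sieve, and a sieve is maximal as soon as it contains the
  identity.\<close>

lemma Cons_in_interp_Var_0:
  assumes "a \<in> Ob A" "sieve A a S" "xs \<in> El (Omega_pow A k) a"
  shows "S # xs \<in> interp A (Suc k) (Var 0) a \<longleftrightarrow> Ident A a \<in> S"
proof -
  have "Ident A a \<in> S \<longleftrightarrow> S = {f \<in> Arr A. Cod A f = a}"
  proof
    assume i: "Ident A a \<in> S"
    have "f \<in> S" if "f \<in> Arr A" "Cod A f = a" for f
      using assms(2) i that assms(1) comp_id_left[of f] unfolding sieve_def by force
    then show "S = {f \<in> Arr A. Cod A f = a}"
      using assms(2) unfolding sieve_def by blast
  qed (use assms in auto)
  then show ?thesis
    using assms by (auto simp: pullback_def truth_def Omega_pow_Suc_iff)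
qed

text \<open>These sieves are the test values for the quantified variable: the one generated by
  \<open>h\<close> contains \<open>h\<close>, and it contains the identity only if \<open>h\<close>
  has a section.\<close>

lemma sieve_principal:
  assumes "h \<in> Arr A"
  shows "sieve A (Cod A h) {h \<cdot> k | k. k \<in> Arr A \<and> Cod A k = Dom A h}"
proof -
  have "\<exists>k'. h \<cdot> k \<cdot> g = h \<cdot> k' \<and> k' \<in> Arr A \<and> Cod A k' = Dom A h"
    if "k \<in> Arr A" "Cod A k = Dom A h" "g \<in> Arr A" "Cod A g = Dom A k" for k g
    using assms that comp_assoc[of g k h] by (intro exI[of _ "k \<cdot> g"]) simp
  then show ?thesis using assms by (auto simp: sieve_def)
qed

text \<open>The formula \<open>\<phi>\<close> is closed, so its truth at \<open>a\<close> is a predicate \<open>p\<close> of \<open>a\<close> alone.\<close>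

lemma interp_All_Or_Imp:
  assumes p: "\<And>a ys. \<lbrakk>a \<in> Ob A; ys \<in> El (Omega_pow A (Suc k)) a\<rbrakk> \<Longrightarrow>
      ys \<in> interp A (Suc k) \<phi> a \<longleftrightarrow> p a"
    and a: "a \<in> Ob A" and xs: "xs \<in> El (Omega_pow A k) a"
  shows "xs \<in> interp A k (All (Or (Var 0) (Imp (Var 0) \<phi>))) a \<longleftrightarrow>
    (\<forall>g\<in>Arr A. Cod A g = a \<longrightarrow>
       (\<forall>h\<in>Arr A. Cod A h = Dom A g \<longrightarrow> is_split_epi A h \<or> p (Dom A h)))" (is "_ \<longleftrightarrow> ?R")
proof -
  interpret O: presheaf A "Omega A"
    by (rule presheaf_Omega) (rule small_category_axioms)
  interpret Pk: cat_presheaf A "Omega_pow A k"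
    by (intro cat_presheaf.intro presheaf_Omega_pow) (rule small_category_axioms)
  interpret PS: cat_presheaf A "Omega_pow A (Suc k)"
    by (intro cat_presheaf.intro presheaf_Omega_pow) (rule small_category_axioms)
  let ?\<psi> = "Or (Var 0) (Imp (Var 0) \<phi>)"
  have Act_Cons: "Act (Omega_pow A (Suc k)) (S # ys) h =
      Act (Omega A) S h # Act (Omega_pow A k) ys h" for S ys h
    by (simp add: Omega_pow_def)
  \<comment> \<open>Forcing of the body at \<open>b\<close> for the value \<open>S\<close>: either
    \<open>S\<close> is maximal, or \<open>p\<close> holds at the domain of every map in
    \<open>S\<close>.\<close>
  have or: "S # ys \<in> interp A (Suc k) ?\<psi> b \<longleftrightarrow>
      Ident A b \<in> S \<or> (\<forall>h\<in>S. p (Dom A h))"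
    if b: "b \<in> Ob A" and S: "sieve A b S" and ys: "ys \<in> El (Omega_pow A k) b" for b S ys
  proof -
    have *: "Act (Omega_pow A (Suc k)) (S # ys) h \<in> interp A (Suc k) (Var 0) (Dom A h) \<longleftrightarrow> h \<in> S"
      "Act (Omega_pow A (Suc k)) (S # ys) h \<in> interp A (Suc k) \<phi> (Dom A h) \<longleftrightarrow> p (Dom A h)"
      if h: "h \<in> Arr A" "Cod A h = b" for h
    proof -
      have Sh: "sieve A (Dom A h) (Act (Omega A) S h)"
        using O.act_in[of h S] h S by (simp add: Omega_def)
      have yh: "Act (Omega_pow A k) ys h \<in> El (Omega_pow A k) (Dom A h)"
        using ys h by simp
      \<comment> \<open>Restricting \<open>S\<close> along \<open>h\<close> gives the maximal sieve
        exactly when \<open>h\<close> belongs to \<open>S\<close>.\<close>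
      have "Ident A (Dom A h) \<in> Act (Omega A) S h \<longleftrightarrow> h \<in> S"
        using h by (simp add: Omega_def)
      then show "Act (Omega_pow A (Suc k)) (S # ys) h \<in> interp A (Suc k) (Var 0) (Dom A h) \<longleftrightarrow> h \<in> S"
        using Cons_in_interp_Var_0[OF _ Sh yh] h unfolding Act_Cons by simp
      have "S # ys \<in> El (Omega_pow A (Suc k)) b" using S ys by (simp add: Omega_pow_Suc_iff)
      then show "Act (Omega_pow A (Suc k)) (S # ys) h \<in> interp A (Suc k) \<phi> (Dom A h) \<longleftrightarrow> p (Dom A h)"
        using p[of "Dom A h"] h by simp
    qed
    have "S # ys \<in> interp A (Suc k) (Imp (Var 0) \<phi>) b \<longleftrightarrow> (\<forall>h\<in>S. p (Dom A h))"
      unfolding interp.simps(4) PS.sub_imp_iff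
      using * b S ys by (auto simp del: interp.simps simp: Omega_pow_Suc_iff sieve_def)
    then show ?thesis
      using Cons_in_interp_Var_0[OF b S ys] by simp
  qed
  have "xs \<in> interp A k (All ?\<psi>) a \<longleftrightarrow>
      (\<forall>g\<in>Arr A. Cod A g = a \<longrightarrow> (\<forall>S. sieve A (Dom A g) S \<longrightarrow>
        S # Act (Omega_pow A k) xs g \<in> interp A (Suc k) ?\<psi> (Dom A g)))"
    unfolding interp.simps(5) Pk.sub_all_iff[OF PS.presheaf_axioms natural_tl]
    using a xs by (auto simp: Omega_pow_Suc_iff simp del: interp.simps)
  also have "\<dots> \<longleftrightarrow> (\<forall>g\<in>Arr A. Cod A g = a \<longrightarrow> (\<forall>S. sieve A (Dom A g) S \<longrightarrow>
      Ident A (Dom A g) \<in> S \<or> (\<forall>h\<in>S. p (Dom A h))))"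
    using xs or by (auto simp del: interp.simps)
  \<comment> \<open>Forwards, \<open>S\<close> is taken to be the sieve generated by
    \<open>h\<close>. Backwards, a split epi in \<open>S\<close> composed with its section puts the
    identity into \<open>S\<close>.\<close>
  also have "\<dots> \<longleftrightarrow> ?R"
  proof (intro ball_cong refl imp_cong iffI allI ballI impI)
    fix g h
    assume L: "\<forall>S. sieve A (Dom A g) S \<longrightarrow> Ident A (Dom A g) \<in> S \<or> (\<forall>h\<in>S. p (Dom A h))"
      and h: "h \<in> Arr A" "Cod A h = Dom A g"
    let ?S = "{h \<cdot> k | k. k \<in> Arr A \<and> Cod A k = Dom A h}"
    have "\<exists>k. h = h \<cdot> k \<and> k \<in> Arr A \<and> Cod A k = Dom A h"
      using h(1) by (intro exI[of _ "Ident A (Dom A h)"]) simp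
    then have "h \<in> ?S" by blast
    moreover have "is_split_epi A h" if id: "Ident A (Dom A g) \<in> ?S"
    proof -
      obtain s where s: "s \<in> Arr A" "Cod A s = Dom A h" "Ident A (Dom A g) = h \<cdot> s"
        using id by blast
      \<comment> \<open>Membership in \<open>?S\<close> does not record the domain of
        \<open>s\<close>; comparing the domains of both sides of the last equation recovers
        it.\<close>
      then have "Dom A s = Cod A h"
        using dom_comp[of s h] dom_id[of "Cod A h"] cod_in[of h] h by simp
      then show ?thesis using s h unfolding is_split_epi_def by auto
    qed
    ultimately show "is_split_epi A h \<or> p (Dom A h)"
      using L sieve_principal[OF h(1)] h(2) by auto
  next
    fix g S
    assume R: "\<forall>h\<in>Arr A. Cod A h = Dom A g \<longrightarrow> is_split_epi A h \<or> p (Dom A h)"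
      and S: "sieve A (Dom A g) S"
    have "Ident A (Dom A g) \<in> S" if "h \<in> S" "is_split_epi A h" for h
    proof -
      have "Cod A h = Dom A g" using S that by (auto simp: sieve_def)
      then show ?thesis using S that unfolding is_split_epi_def sieve_def by metis
    qed
    then show "Ident A (Dom A g) \<in> S \<or> (\<forall>h\<in>S. p (Dom A h))"
      using R S unfolding sieve_def by blast
  qed
  finally show ?thesis .
qed

text \<open>When all maps are monic, split epis are isomorphisms, so the inner clause of
  \<open>interp_All_Or_Imp\<close> is the recursion for height at the domain of \<open>g\<close>.
  The outer quantifier over \<open>g\<close> is absorbed because height decreases along monos. The
  context length \<open>k\<close> varies in the induction, since the closed subformula is
  interpreted under one more variable.\<close>

lemma interp_IBD_iff_height_le:
  assumes mono: "\<And>f. f \<in> Arr A \<Longrightarrow> is_mono A f"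
    and "a \<in> Ob A" "xs \<in> El (Omega_pow A k) a"
  shows "xs \<in> interp A k (IBD n) a \<longleftrightarrow> height_le A a n"
proof -
  have iso: "is_split_epi A h \<longleftrightarrow> is_iso A h" if "h \<in> Arr A" for h
    using iso_of_split_epi_mono split_epi_of_iso mono that by blast
  have mono_iff: "is_mono A f \<longleftrightarrow> f \<in> Arr A" for f
    using mono[of f] is_mono_in_Arr[of A f] by auto
  have height: "height_le A b n \<longleftrightarrow> (\<forall>g\<in>Arr A. Cod A g = b \<longrightarrow> height_le A (Dom A g) n)"
    if "b \<in> Ob A" for b n
  proof (intro iffI ballI impI)
    fix g assume "height_le A b n" "g \<in> Arr A" "Cod A g = b"
    then show "height_le A (Dom A g) n" using height_le_mono_dom mono by blast
  next
    assume "\<forall>g\<in>Arr A. Cod A g = b \<longrightarrow> height_le A (Dom A g) n"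
    then have "height_le A (Dom A (Ident A b)) n" using that id_in cod_id by blast
    then show "height_le A b n" using that by simp
  qed
  show ?thesis
    using assms(2,3)
  proof (induction n arbitrary: k a xs)
    case 0
    \<comment> \<open>Falsity is forced nowhere, so \<open>p\<close> is constantly
      \<open>False\<close> here.\<close>
    have "xs \<in> interp A k (IBD 0) a \<longleftrightarrow> (\<forall>g\<in>Arr A. Cod A g = a \<longrightarrow>
        (\<forall>h\<in>Arr A. Cod A h = Dom A g \<longrightarrow> is_split_epi A h \<or> False))"
      unfolding IBD.simps IBD_minus_infinity_def
      by (rule interp_All_Or_Imp) (use 0 in auto)
    also have "\<dots> \<longleftrightarrow> (\<forall>g\<in>Arr A. Cod A g = a \<longrightarrow> height_le A (Dom A g) 0)"
      unfolding height_le_0 by (auto simp: mono_iff iso)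
    finally show ?case using height 0 by simp
  next
    case (Suc n)
    have "xs \<in> interp A k (IBD (Suc n)) a \<longleftrightarrow> (\<forall>g\<in>Arr A. Cod A g = a \<longrightarrow>
        (\<forall>h\<in>Arr A. Cod A h = Dom A g \<longrightarrow> is_split_epi A h \<or> height_le A (Dom A h) n))"
      unfolding IBD.simps(2) by (rule interp_All_Or_Imp) (use Suc in auto)
    also have "\<dots> \<longleftrightarrow> (\<forall>g\<in>Arr A. Cod A g = a \<longrightarrow> height_le A (Dom A g) (Suc n))"
      unfolding height_le_Suc by (auto simp: mono_iff iso)
    finally show ?case using height[of a "Suc n"] Suc.prems by simp
  qed
qed

corollary holds_IBD_iff_height_le:
  assumes "\<And>f. f \<in> Arr A \<Longrightarrow> is_mono A f"
  shows "holds_in_presheaves A (IBD n) \<longleftrightarrow> (\<forall>a\<in>Ob A. height_le A a n)"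
proof -
  have El0: "El (Omega_pow A 0) a = {[]}" for a by (auto simp: Omega_pow_def)
  \<comment> \<open>Over the terminal presheaf, a subobject is everything at \<open>a\<close> as
    soon as it contains the empty list.\<close>
  have sub: "interp A 0 (IBD n) a \<subseteq> {[]}" if a: "a \<in> Ob A" for a
  proof -
    have "subpresheaf A (Omega_pow A 0) (interp A 0 (IBD n))"
      by (cases n) (simp_all add: subpresheaf_sub_all)
    then show ?thesis using El0 subpresheafD by fastforce
  qed
  have "interp A 0 (IBD n) a = El (Omega_pow A 0) a \<longleftrightarrow> height_le A a n" if a: "a \<in> Ob A" for a
    using interp_IBD_iff_height_le[OF assms a, of "[]" 0] sub[OF a] unfolding El0 by blast
  then show ?thesis unfolding holds_in_presheaves_def by blast
qed

end

section \<open>Minimal elements\<close>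

lemma full_subcat_simps [simp]:
  "Ob (full_subcat A P) = {a \<in> Ob A. P a}"
  "Arr (full_subcat A P) = {f \<in> Arr A. P (Dom A f) \<and> P (Cod A f)}"
  "Dom (full_subcat A P) = Dom A" "Cod (full_subcat A P) = Cod A"
  "Ident (full_subcat A P) = Ident A" "Comp (full_subcat A P) = Comp A"
  by (simp_all add: full_subcat_def)

lemma full_subcat_iso_iff:
  assumes "f \<in> Arr (full_subcat A P)"
  shows "is_iso (full_subcat A P) f \<longleftrightarrow> is_iso A f"
  using assms unfolding is_iso_def by auto

text \<open>Monicity in \<open>A\<close> is minimality of the domain, and it survives in the
  subcategory, where there are fewer test maps. This makes the forcing result for categories of
  monos applicable.\<close>

lemma minimal_subcat_mono:
  assumes "f \<in> Arr (minimal_subcat A)"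
  shows "is_mono A f" "is_mono (minimal_subcat A) f"
proof -
  show m: "is_mono A f"
    using assms unfolding minimal_subcat_def minimal_ob_def by auto
  show "is_mono (minimal_subcat A) f"
    using assms is_monoD[OF m] unfolding is_mono_def minimal_subcat_def by simp
qed

section \<open>The category of elements and its minimal objects\<close>

context cat_presheaf
begin

abbreviation "E \<equiv> elements A X"

lemma elements_Arr_iff:
  "((x, a), f, (y, b)) \<in> Arr E \<longleftrightarrow> f \<in> Arr A \<and> Dom A f = a \<and> Cod A f = b \<and> y \<in> El X b \<and> Act X y f = x"
  by (auto simp: elements_def)

lemma elements_ArrE:
  assumes "F \<in> Arr E"
  obtains f y where "F = ((Act X y f, Dom A f), f, (y, Cod A f))" "f \<in> Arr A" "y \<in> El X (Cod A f)"
  using assms by (auto simp: elements_def)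

lemma elements_simps:
  "Dom E (p, f, q) = p" "Cod E (p, f, q) = q"
  "(x, a) \<in> Ob E \<longleftrightarrow> a \<in> Ob A \<and> x \<in> El X a"
  "Ident E (x, a) = ((x, a), Ident A a, (x, a))"
  "Comp E (q', g, r) (p, f, q) = (p, g \<cdot> f, r)"
  by (simp_all add: elements_def)

text \<open>Two maps equalised by \<open>f\<close> restrict \<open>Act X y f\<close> to the same
  element, so they lift to a parallel pair in the category of elements.\<close>

lemma elements_mono_iff:
  assumes f: "f \<in> Arr A" and y: "y \<in> El X (Cod A f)"
  shows "is_mono E ((Act X y f, Dom A f), f, (y, Cod A f)) \<longleftrightarrow> is_mono A f" (is "is_mono E ?F \<longleftrightarrow> _")
proof
  assume m: "is_mono E ?F"
  show "is_mono A f"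
    unfolding is_mono_def
  proof (intro conjI ballI impI f)
    fix g h assume g: "g \<in> Arr A" and h: "h \<in> Arr A"
      and c: "Cod A g = Dom A f \<and> Cod A h = Dom A f \<and> Dom A g = Dom A h \<and> f \<cdot> g = f \<cdot> h"
    let ?x = "Act X y f"
    let ?lift = "\<lambda>k. ((Act X ?x g, Dom A g), k, (?x, Dom A f))"
    have "Act X ?x h = Act X ?x g"
      using act_comp[of g f y] act_comp[of h f y] c f g h y by simp
    then have "?lift g = ?lift h"
      by - (rule is_monoD[OF m], use c f g h y in \<open>simp_all add: elements_Arr_iff elements_simps\<close>)
    then show "g = h" by simp
  qed
next
  assume m: "is_mono A f"
  show "is_mono E ?F"
    unfolding is_mono_def
  proof (intro conjI ballI impI)
    show "?F \<in> Arr E" using f y by (simp add: elements_Arr_iff)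
    fix G H assume "G \<in> Arr E" "H \<in> Arr E"
      and "Cod E G = Dom E ?F \<and> Cod E H = Dom E ?F \<and> Dom E G = Dom E H \<and>
        ?F \<cdot>\<^bsub>E\<^esub> G = ?F \<cdot>\<^bsub>E\<^esub> H"
    then show "G = H"
      by (auto elim!: elements_ArrE simp: elements_simps intro: is_monoD[OF m])
  qed
qed

lemma elements_iso_iff:
  assumes f: "f \<in> Arr A" and y: "y \<in> El X (Cod A f)"
  shows "is_iso E ((Act X y f, Dom A f), f, (y, Cod A f)) \<longleftrightarrow> is_iso A f" (is "is_iso E ?F \<longleftrightarrow> _")
proof
  assume "is_iso E ?F"
  then obtain G where "G \<in> Arr E" "Dom E G = Cod E ?F" "Cod E G = Dom E ?F"
    "G \<cdot>\<^bsub>E\<^esub> ?F = Ident E (Dom E ?F)" "?F \<cdot>\<^bsub>E\<^esub> G = Ident E (Cod E ?F)"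
    unfolding is_iso_def by blast
  then show "is_iso A f"
    using f unfolding is_iso_def by (auto elim!: elements_ArrE simp: elements_simps)
next
  assume "is_iso A f"
  then obtain g where g: "g \<in> Arr A" "Dom A g = Cod A f" "Cod A g = Dom A f"
    "g \<cdot> f = Ident A (Dom A f)" "f \<cdot> g = Ident A (Cod A f)"
    unfolding is_iso_def by blast
  then have "Act X (Act X y f) g = y"
    using act_comp[of g f y] f y by simp
  then show "is_iso E ?F"
    using f g y unfolding is_iso_def
    by (auto simp: elements_simps elements_Arr_iff
        intro!: bexI[of _ "((y, Cod A f), g, (Act X y f, Dom A f))"])
qed

text \<open>Transfer along the projection to \<open>A\<close>, which preserves and reflects monos
  and isomorphisms.\<close>

lemma minimal_height_le_iff:
  assumes sr: "strongly_regular A X" and p: "p \<in> Ob (minimal_subcat E)"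
  shows "height_le (minimal_subcat E) p n \<longleftrightarrow> height_le A (snd p) n"
proof (rule height_le_transfer[where P = "Ob (minimal_subcat E)", OF p])
  let ?D = "minimal_subcat E"
  have E: "small_category E" by (rule small_category_elements) (rule presheaf_axioms)
  {
    fix p F assume "is_mono ?D F" and p: "Cod ?D F = p"
    then have F: "F \<in> Arr ?D" by (simp add: is_mono_in_Arr)
    have iso: "is_iso ?D F \<longleftrightarrow> is_iso E F"
      using F full_subcat_iso_iff[of F] unfolding minimal_subcat_def by simp
    have FE: "F \<in> Arr E" using F by (simp add: minimal_subcat_def)
    obtain f y where f: "F = ((Act X y f, Dom A f), f, (y, Cod A f))" "f \<in> Arr A" "y \<in> El X (Cod A f)"
      using FE by (rule elements_ArrE)
    have "is_mono A f" using minimal_subcat_mono(1)[OF F] f elements_mono_iff by simp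
    moreover have "is_iso A f \<longleftrightarrow> is_iso ?D F" using iso f elements_iso_iff by simp
    moreover have "Dom ?D F \<in> Ob ?D"
      using F small_category.dom_in[OF E FE] by (simp add: minimal_subcat_def)
    moreover have "Cod A f = snd p" "Dom A f = snd (Dom ?D F)"
      using p f by (auto simp: minimal_subcat_def elements_simps)
    ultimately show "Dom ?D F \<in> Ob ?D \<and> (\<exists>m. is_mono A m \<and> Cod A m = snd p \<and>
        Dom A m = snd (Dom ?D F) \<and> (is_iso A m \<longleftrightarrow> is_iso ?D F))"
      by blast
  next
    fix p m assume p: "p \<in> Ob ?D" and m: "is_mono A m" "Cod A m = snd p"
    \<comment> \<open>The lift of \<open>m\<close> with codomain \<open>p\<close>, as in any
      discrete fibration.\<close>
    define F where "F = ((Act X (fst p) m, Dom A m), m, p)"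
    have x: "m \<in> Arr A" "fst p \<in> El X (Cod A m)" and pE: "minimal_ob E p"
      using p m is_mono_in_Arr[OF m(1)]
      by (cases p; simp add: minimal_subcat_def elements_simps)+
    have F: "F = ((Act X (fst p) m, Dom A m), m, (fst p, Cod A m))"
      using m(2) by (simp add: F_def)
    have mono: "is_mono E F" unfolding F using elements_mono_iff x m(1) by blast
    have cod: "Cod E F = p" and dom: "Dom E F = (Act X (fst p) m, Dom A m)"
      by (simp_all add: F_def elements_simps)
    \<comment> \<open>Strong regularity keeps the lift inside the subcategory of minimal
      elements.\<close>
    then have "minimal_ob E (Dom E F)"
      using sr mono pE unfolding strongly_regular_def by metis
    then have FD: "F \<in> Arr ?D"
      using is_mono_in_Arr[OF mono] pE cod by (simp add: minimal_subcat_def)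
    have "is_iso ?D F \<longleftrightarrow> is_iso A m"
      using FD full_subcat_iso_iff[of F] elements_iso_iff x F unfolding minimal_subcat_def by metis
    then show "\<exists>f. is_mono ?D f \<and> Cod ?D f = p \<and> Dom A m = snd (Dom ?D f) \<and>
        (is_iso A m \<longleftrightarrow> is_iso ?D f)"
      using minimal_subcat_mono(2)[OF FD] cod dom by (intro exI[of _ F]) (simp add: minimal_subcat_def)
  }
qed

text \<open>Otherwise every element reachable from \<open>(x, a)\<close> has a non-monic map out of
  it. The strong epi part of that map is not invertible and leads to another reachable element;
  iterating contradicts well-foundedness.\<close>

lemma map_to_minimal:
  assumes wf: "well_founded_cat A" and fact: "has_strong_epi_mono_factorizations A"
    and a: "a \<in> Ob A" and x: "x \<in> El X a"
  obtains f z where "f \<in> Arr A" "Dom A f = a" "z \<in> El X (Cod A f)" "Act X z f = x"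
    "minimal_ob E (z, Cod A f)"
proof -
  define reach where "reach z c \<longleftrightarrow>
    (\<exists>f\<in>Arr A. Dom A f = a \<and> Cod A f = c \<and> z \<in> El X c \<and> Act X z f = x)" for z c
  have "\<exists>z c. reach z c \<and> minimal_ob E (z, c)"
  proof (rule ccontr)
    assume none: "\<nexists>z c. reach z c \<and> minimal_ob E (z, c)"
    have step: "\<exists>e z'. reach z' (Cod A e) \<and> is_strong_epi A e \<and> \<not> is_iso A e \<and> Dom A e = c"
      if r: "reach z c" for z c
    proof -
      from r obtain f where f: "f \<in> Arr A" "Dom A f = a" "Cod A f = c" "z \<in> El X c" "Act X z f = x"
        unfolding reach_def by blast
      have "(z, c) \<in> Ob E" using f by (auto simp: elements_simps)
      then obtain G where G: "G \<in> Arr E" "Dom E G = (z, c)" "\<not> is_mono E G"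
        using none r unfolding minimal_ob_def by blast
      obtain g y where g: "G = ((Act X y g, Dom A g), g, (y, Cod A g))" "g \<in> Arr A" "y \<in> El X (Cod A g)"
        using G(1) by (rule elements_ArrE)
      have nm: "\<not> is_mono A g" using G(3) g elements_mono_iff by simp
      have gz: "Act X y g = z" "Dom A g = c" using G(2) g(1) by (simp_all add: elements_simps)
      obtain e m where em: "is_strong_epi A e" "is_mono A m" "Dom A m = Cod A e" "g = m \<cdot> e"
        using fact g(2) unfolding has_strong_epi_mono_factorizations_def by blast
      have arr: "e \<in> Arr A" "m \<in> Arr A"
        using em by (auto simp: is_strong_epi_def is_mono_def)
      have e: "Dom A e = c" using gz em arr by simp
      have y: "y \<in> El X (Cod A m)" using g(3) em arr by simp
      \<comment> \<open>If \<open>e\<close> were invertible, \<open>g\<close> would be a composite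
        of two monos.\<close>
      have "\<not> is_iso A e"
        using nm em mono_comp[of e m] mono_of_iso by auto
      moreover have "reach (Act X y m) (Cod A e)"
        unfolding reach_def
      proof (intro bexI conjI)
        show "e \<cdot> f \<in> Arr A" "Dom A (e \<cdot> f) = a" "Cod A (e \<cdot> f) = Cod A e"
          using f arr e by simp_all
        show y': "Act X y m \<in> El X (Cod A e)" using act_in[of m y] arr y em by simp
        have "Act X (Act X y m) e = z"
          using act_comp[of e m y] arr y em gz by simp
        then show "Act X (Act X y m) (e \<cdot> f) = x"
          using act_comp[of f e "Act X y m"] f arr e y' by simp
      qed
      ultimately show ?thesis using em(1) e by blast
    qed
    \<comment> \<open>A state pairs a strong epi with a reachable element over its codomain, so that
      dependent choice can demand composability of successive epis.\<close>
    define Q where "Q s \<longleftrightarrow> (case s of (e, z) \<Rightarrow>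
      reach z (Cod A e) \<and> is_strong_epi A e \<and> \<not> is_iso A e)" for s
    have "reach x a"
      unfolding reach_def using a x by (intro bexI[of _ "Ident A a"]) simp_all
    then obtain s0 where s0: "Q s0" using step unfolding Q_def by fast
    have "\<exists>t. Q t \<and> Cod A (fst s) = Dom A (fst t)" if "Q s" for s
      using that step[of "snd s" "Cod A (fst s)"] unfolding Q_def by (auto split: prod.splits)
    with s0 obtain s where s: "\<And>i. Q (s i)" "\<And>i. Cod A (fst (s i)) = Dom A (fst (s (Suc i)))"
      using dependent_nat_choice[of "\<lambda>_. Q" "\<lambda>_ s t. Cod A (fst s) = Dom A (fst t)"] by metis
    then have "is_strong_epi A (fst (s i)) \<and> \<not> is_iso A (fst (s i))" for i
      using s(1)[of i] unfolding Q_def by (cases "s i") simp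
    then show False
      using wf[unfolded well_founded_cat_def, rule_format, of "\<lambda>i. fst (s i)"] s(2) by blast
  qed
  then show thesis using that unfolding reach_def by blast
qed

section \<open>Skeleta, dimension and the heights of minimal elements\<close>

lemma skeleton_El_iff:
  assumes "d \<in> Ob A"
  shows "x \<in> El (skeleton A X n) d \<longleftrightarrow>
    (\<exists>g\<in>Arr A. Dom A g = d \<and> height_le A (Cod A g) n \<and> (\<exists>z\<in>El X (Cod A g). x = Act X z g))"
proof
  assume "x \<in> El (skeleton A X n) d"
  then obtain f c y where f: "f \<in> Arr A" "Dom A f = d" and c: "height_le A c n"
    and "factors_through A f c" and y: "y \<in> El X (Cod A f)" "x = Act X y f"
    by (auto simp: skeleton_def height_subcat_def)
  then obtain g h where "g \<in> Arr A" "h \<in> Arr A" "Dom A g = Dom A f" "Cod A g = c" "Dom A h = c"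
    "Cod A h = Cod A f" "f = h \<cdot> g"
    unfolding factors_through_def by blast
  \<comment> \<open>The factor \<open>h\<close> is absorbed into the element:
    \<open>Act X y h\<close> lies over the object \<open>c\<close> of bounded height.\<close>
  then show "\<exists>g\<in>Arr A. Dom A g = d \<and> height_le A (Cod A g) n \<and> (\<exists>z\<in>El X (Cod A g). x = Act X z g)"
    using f c y act_comp[of g h y] act_in[of h y]
    by (intro bexI[of _ g] conjI bexI[of _ "Act X y h"]) simp_all
next
  assume "\<exists>g\<in>Arr A. Dom A g = d \<and> height_le A (Cod A g) n \<and> (\<exists>z\<in>El X (Cod A g). x = Act X z g)"
  then obtain g z where g: "g \<in> Arr A" "Dom A g = d" "height_le A (Cod A g) n"
    "z \<in> El X (Cod A g)" "x = Act X z g" by blast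
  then have "factors_through A g (Cod A g)"
    unfolding factors_through_def by (intro bexI[of _ g] bexI[of _ "Ident A (Cod A g)"]) simp_all
  then show "x \<in> El (skeleton A X n) d"
    using g cod_in[of g] by (auto simp: skeleton_def height_subcat_def intro!: bexI[of _ g] exI[of _ "Cod A g"])
qed

text \<open>A natural inverse of the inclusion can only be the identity on elements.\<close>

lemma dim_le_iff: "dim_le A X n \<longleftrightarrow> (\<forall>a\<in>Ob A. El X a \<subseteq> El (skeleton A X n) a)"
proof
  assume "dim_le A X n"
  then obtain G where G: "natural A X (skeleton A X n) G" "\<forall>a\<in>Ob A. \<forall>y\<in>El X a. G a y = y"
    unfolding dim_le_def natural_iso_def by blast
  then show "\<forall>a\<in>Ob A. El X a \<subseteq> El (skeleton A X n) a"
    unfolding natural_def by (metis subsetI)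
next
  assume sub: "\<forall>a\<in>Ob A. El X a \<subseteq> El (skeleton A X n) a"
  have "natural A (skeleton A X n) X (\<lambda>_ x. x)"
    by (auto simp: natural_def skeleton_def)
  moreover have "natural A X (skeleton A X n) (\<lambda>_ x. x)"
    using sub by (auto simp: natural_def skeleton_def[of A X n, THEN arg_cong[of _ _ Act]])
  ultimately show "dim_le A X n"
    unfolding dim_le_def natural_iso_def by (blast intro: exI[of _ "\<lambda>_ x. x"])
qed

lemma dim_le_iff_minimal_height_le:
  assumes "well_founded_cat A" "has_strong_epi_mono_factorizations A"
  shows "dim_le A X n \<longleftrightarrow> (\<forall>p\<in>Ob (minimal_subcat E). height_le A (snd p) n)"
proof
  assume dim: "dim_le A X n"
  show "\<forall>p\<in>Ob (minimal_subcat E). height_le A (snd p) n"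
  proof
    fix p assume p: "p \<in> Ob (minimal_subcat E)"
    obtain x a where xa: "p = (x, a)" by (cases p)
    then have a: "a \<in> Ob A" "x \<in> El X a" and min: "minimal_ob E (x, a)"
      using p by (auto simp: minimal_subcat_def elements_simps)
    then have "x \<in> El (skeleton A X n) a" using dim dim_le_iff by blast
    then obtain g z where g: "g \<in> Arr A" "Dom A g = a" "height_le A (Cod A g) n"
      "z \<in> El X (Cod A g)" "x = Act X z g"
      using skeleton_El_iff a by blast
    have "((Act X z g, Dom A g), g, (z, Cod A g)) \<in> Arr E" using g by (simp add: elements_Arr_iff)
    \<comment> \<open>Minimality of \<open>(x, a)\<close> makes the lift of \<open>g\<close> monic,
      hence \<open>g\<close> itself.\<close>
    then have "is_mono E ((Act X z g, Dom A g), g, (z, Cod A g))"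
      using min g unfolding minimal_ob_def by (simp add: elements_simps)
    then have "is_mono A g" using elements_mono_iff g(1,4) by blast
    then show "height_le A (snd p) n" using height_le_mono_dom g xa by force
  qed
next
  assume R: "\<forall>p\<in>Ob (minimal_subcat E). height_le A (snd p) n"
  show "dim_le A X n"
    unfolding dim_le_iff
  proof (intro ballI subsetI)
    fix a x assume a: "a \<in> Ob A" "x \<in> El X a"
    \<comment> \<open>By \<open>R\<close> the codomain of such an \<open>f\<close> has height at
      most \<open>n\<close>, so \<open>f\<close> witnesses that \<open>x\<close> lies in the
      skeleton.\<close>
    obtain f z where f: "f \<in> Arr A" "Dom A f = a" "z \<in> El X (Cod A f)" "Act X z f = x"
      "minimal_ob E (z, Cod A f)"
      using map_to_minimal[OF assms a] .
    have "(z, Cod A f) \<in> Ob (minimal_subcat E)"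
      using f(5) by (simp add: minimal_subcat_def minimal_ob_def)
    then show "x \<in> El (skeleton A X n) a"
      using R f a skeleton_El_iff by force
  qed
qed

end

theorem theorem8p4:
  fixes C :: "('o, 'a) cat" and X :: "('o, 'a, 'x) psh" and n :: nat
  assumes "small_category C"
    and "well_founded_cat C"
    and "has_strong_epi_mono_factorizations C"
    and "presheaf C X"
    and "strongly_regular C X"
  shows "dim_le C X n \<longleftrightarrow> holds_in_presheaves (minimal_subcat (elements C X)) (IBD n)"
proof -
  interpret cat_presheaf C X by (rule cat_presheaf.intro) fact
  interpret D: cat_category "minimal_subcat (elements C X)"
    unfolding minimal_subcat_def
    by (intro cat_category.intro small_category_full_subcat small_category_elements) fact
  have "dim_le C X n \<longleftrightarrow> (\<forall>p\<in>Ob (minimal_subcat E). height_le C (snd p) n)"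
    by (rule dim_le_iff_minimal_height_le) fact+
  also have "\<dots> \<longleftrightarrow> (\<forall>p\<in>Ob (minimal_subcat E). height_le (minimal_subcat E) p n)"
    using minimal_height_le_iff[OF assms(5)] by simp
  also have "\<dots> \<longleftrightarrow> holds_in_presheaves (minimal_subcat E) (IBD n)"
    by (rule D.holds_IBD_iff_height_le[symmetric]) (rule minimal_subcat_mono(2))
  finally show ?thesis .
qed

end
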